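(* Let $(X,T)$ be a topological dynamical system. Then $(X,T)$ has the (global) strong topological Rokhlin property if and only if $(X,T)$ has the marker property.
   Context: A topological dynamical system $(X,T)$ is a compact metric space $X$ together with a homeomorphism $T:X\to X$. Marker property: a subset $F\subset X$ is an $n$-marker ($n\in\mathbb{N}$) if (1) $F\cap T^{i}(F)=\emptyset$ for $i=1,2,\ldots,n-1$, and (2) there is $m\in\mathbb{N}$ such that the sets $T^{i}(F)$, $1\le i\le m$, cover $X$. The system $(X,T)$ has the marker property if it has an open $n$-marker for every $n\in\mathbb{N}$. (Global) strong topological Rokhlin property: for every $n\in\mathbb{N}$ there exists a continuous function $f:X\to\mathbb{R}$ such that, for the exceptional set $E_f=\{x\in X : f(Tx)\neq f(x)+1\}$, the sets $T^{-i}(E_f)$, $i=0,1,\ldots,n-1$, are pairwise disjoint. *)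

theory Defs
  imports "HOL-Analysis.Analysis"
begin

text \<open>
  The phase space is a carrier set \<open>X\<close> with the subspace topology; nothing is assumed
  about the values of \<open>T\<close> outside \<open>X\<close>.  Natural-number parameters of the notions below
  range over the positive integers.
\<close>

definition topological_dynamical_system :: "'a::metric_space set \<Rightarrow> ('a \<Rightarrow> 'a) \<Rightarrow> bool" where
  "topological_dynamical_system X T \<longleftrightarrow> compact X \<and> (\<exists>S. homeomorphism X X T S)"

definition marker :: "'a::metric_space set \<Rightarrow> ('a \<Rightarrow> 'a) \<Rightarrow> nat \<Rightarrow> 'a set \<Rightarrow> bool" where
  "marker X T n F \<longleftrightarrow>
     F \<subseteq> X \<and>
     (\<forall>i\<in>{1..<n}. F \<inter> (T ^^ i) ` F = {}) \<and>
     (\<exists>m\<ge>1. X \<subseteq> (\<Union>i\<in>{1..m}. (T ^^ i) ` F))"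

definition marker_property :: "'a::metric_space set \<Rightarrow> ('a \<Rightarrow> 'a) \<Rightarrow> bool" where
  "marker_property X T \<longleftrightarrow>
     (\<forall>n\<ge>1. \<exists>F. openin (top_of_set X) F \<and> marker X T n F)"

definition exceptional_set :: "'a set \<Rightarrow> ('a \<Rightarrow> 'a) \<Rightarrow> ('a \<Rightarrow> real) \<Rightarrow> 'a set" where
  "exceptional_set X T f = {x \<in> X. f (T x) \<noteq> f x + 1}"

text \<open>
  Disjointness is that of the indexed family, so two sets with different indices
  that happen to coincide must be empty.
\<close>

definition strong_topological_Rokhlin_property ::
    "'a::metric_space set \<Rightarrow> ('a \<Rightarrow> 'a) \<Rightarrow> bool" where
  "strong_topological_Rokhlin_property X T \<longleftrightarrow>
     (\<forall>n\<ge>1. \<exists>f. continuous_on X f \<and>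
        disjoint_family_on (\<lambda>i. (T ^^ i) -` exceptional_set X T f \<inter> X) {0..<n})"

end

theory Submission
  imports Defs
begin

text \<open>
  If the exceptional set \<open>E\<close> of \<open>f\<close> meets no \<open>T\<^sup>i(E)\<close> with \<open>0 < i < n\<close>, then \<open>E\<close> itself is an
  open \<open>n\<close>-marker: an orbit that avoids \<open>E\<close> for \<open>k\<close> steps increases \<open>f\<close> by \<open>k\<close>, and \<open>f\<close> is bounded.
  Conversely, given an open marker \<open>F\<close>, let \<open>w\<close> be a continuous function with values in \<open>[0,1]\<close>,
  nonzero exactly on \<open>F\<close>, that takes the value \<open>1\<close> along every orbit within boundedly many steps.
  Walk backwards from \<open>x\<close>, stopping at each visited point \<open>y\<close> with probability \<open>w(y)\<close>, and let
  \<open>f(x)\<close> be the expected number of steps. Then \<open>f(Tx) = (1 - w(Tx)) (f(x) + 1)\<close>, so the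
  exceptional set of \<open>f\<close> is \<open>T\<^sup>-\<^sup>1(F)\<close>.
\<close>

lemma marker_disjoint:
  assumes "marker X T n F" "1 \<le> i" "i < n"
  shows "F \<inter> (T ^^ i) ` F = {}"
proof -
  have "\<forall>i\<in>{1..<n}. F \<inter> (T ^^ i) ` F = {}"
    using assms(1) unfolding marker_def by blast
  then show ?thesis using assms(2,3) by (meson atLeastLessThan_iff)
qed

lemma funpow_mem:
  assumes "T ` X \<subseteq> X" "x \<in> X"
  shows "(T ^^ k) x \<in> X"
  using assms by (induction k) auto

lemma continuous_on_funpow:
  assumes "continuous_on X T" "T ` X \<subseteq> X"
  shows "continuous_on X (T ^^ k)"
proof (induction k)
  case 0
  then show ?case by (simp add: id_def)
next
  case (Suc k)
  have "(T ^^ k) ` X \<subseteq> X" using funpow_mem[OF assms(2)] by blast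
  then show ?case
    using continuous_on_compose2[OF assms(1) Suc] by (simp add: o_def)
qed

lemma funpow_left_inverse:
  assumes "T ` X \<subseteq> X" "\<And>x. x \<in> X \<Longrightarrow> S (T x) = x" "x \<in> X"
  shows "(S ^^ k) ((T ^^ k) x) = x"
  using assms(3)
proof (induction k arbitrary: x)
  case (Suc k)
  then have "(T ^^ k) x \<in> X" by (simp add: funpow_mem[OF assms(1)])
  then show ?case using Suc assms(2) by (simp add: funpow_Suc_right del: funpow.simps(2)) (simp flip: funpow_swap1)
qed simp

lemma iterate_outside_exceptional_set:
  assumes "T ` X \<subseteq> X" "x \<in> X" "\<And>i. i < k \<Longrightarrow> (T ^^ i) x \<notin> exceptional_set X T f"
  shows "f ((T ^^ k) x) = f x + real k"
  using assms(3)
proof (induction k)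
  case (Suc k)
  have "(T ^^ k) x \<notin> exceptional_set X T f" using Suc.prems by blast
  then show ?case
    using Suc funpow_mem[OF assms(1,2), of k] by (simp add: exceptional_set_def)
qed simp

lemma openin_exceptional_set:
  assumes "continuous_on X T" "T ` X \<subseteq> X" "continuous_on X f"
  shows "openin (top_of_set X) (exceptional_set X T f)"
proof -
  have "continuous_on X (\<lambda>x. f (T x))"
    using continuous_on_compose[OF assms(1)] continuous_on_subset[OF assms(3,2)]
    by (simp add: o_def)
  then have "continuous_on X (\<lambda>x. f (T x) - f x - 1)"
    using assms(3) by (intro continuous_intros)
  then have "openin (top_of_set X) (X \<inter> (\<lambda>x. f (T x) - f x - 1) -` (- {0}))"
    by (rule continuous_openin_preimage_gen) auto
  moreover have "X \<inter> (\<lambda>x. f (T x) - f x - 1) -` (- {0}) = exceptional_set X T f"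
    by (auto simp: exceptional_set_def)
  ultimately show ?thesis by simp
qed

lemma exceptional_set_hit:
  assumes "compact X" "T ` X \<subseteq> X" "continuous_on X f"
  obtains m where "m \<ge> 1" "\<And>x. x \<in> X \<Longrightarrow> \<exists>i<m. (T ^^ i) x \<in> exceptional_set X T f"
proof -
  have "bounded (f ` X)"
    using assms(1,3) compact_continuous_image compact_imp_bounded by blast
  then obtain B where B: "\<And>x. x \<in> X \<Longrightarrow> \<bar>f x\<bar> \<le> B"
    unfolding bounded_iff by auto
  \<comment> \<open>Two values of \<open>f\<close> on \<open>X\<close> differ by at most
    \<open>2 * B\<close>, which excludes \<open>m\<close> successive increments by 1. The absolute
    value forces \<open>m \<ge> 1\<close> even if \<open>X\<close> is empty and \<open>B\<close>
    negative.\<close>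
  obtain m :: nat where m: "real m > 2 * \<bar>B\<bar>" using reals_Archimedean2 by blast
  have "\<exists>i<m. (T ^^ i) x \<in> exceptional_set X T f" if x: "x \<in> X" for x
  proof (rule ccontr)
    assume "\<not> ?thesis"
    then have "f ((T ^^ m) x) = f x + real m"
      using iterate_outside_exceptional_set[OF assms(2) x] by blast
    then show False using B[OF x] B[OF funpow_mem[OF assms(2) x, of m]] m by linarith
  qed
  moreover have "m \<ge> 1" using m by (cases m) auto
  ultimately show ?thesis using that by blast
qed

lemma marker_exceptional_set:
  assumes "compact X" and hom: "homeomorphism X X T S" and f: "continuous_on X f"
    and disj: "disjoint_family_on (\<lambda>i. (T ^^ i) -` exceptional_set X T f \<inter> X) {0..<n}"
  shows "marker X T n (exceptional_set X T f)"
proof -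
  let ?E = "exceptional_set X T f"
  have TX: "T ` X \<subseteq> X" and SX: "S ` X \<subseteq> X" and TS: "\<And>x. x \<in> X \<Longrightarrow> T (S x) = x"
    using hom by (auto simp: homeomorphism_def)
  have EX: "?E \<subseteq> X" by (auto simp: exceptional_set_def)
  have "?E \<inter> (T ^^ i) ` ?E = {}" if "i \<in> {1..<n}" for i
  proof -
    \<comment> \<open>A point of \<open>?E\<close> whose \<open>i\<close>-th iterate is again in
      \<open>?E\<close> would lie in the preimages with indices 0 and \<open>i\<close>.\<close>
    have "((T ^^ 0) -` ?E \<inter> X) \<inter> ((T ^^ i) -` ?E \<inter> X) = {}"
      by (rule disjoint_family_onD[OF disj]) (use that in auto)
    then show ?thesis using EX by auto
  qed
  moreover obtain m where "m \<ge> 1" and hit: "\<And>x. x \<in> X \<Longrightarrow> \<exists>i<m. (T ^^ i) x \<in> ?E"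
    using exceptional_set_hit[OF assms(1) TX f] by blast
  have "X \<subseteq> (\<Union>i\<in>{1..m}. (T ^^ i) ` ?E)"
  proof
    fix x assume x: "x \<in> X"
    \<comment> \<open>Start \<open>m\<close> steps in the past of \<open>x\<close>. The orbit enters
      \<open>?E\<close> at some time \<open>i < m\<close> and reaches \<open>x\<close> after
      \<open>m - i\<close> further steps; strictness keeps this exponent at least 1, as the cover in
      \<open>marker\<close> demands.\<close>
    obtain i where i: "i < m" "(T ^^ i) ((S ^^ m) x) \<in> ?E"
      using hit[OF funpow_mem[OF SX x, of m]] by blast
    have "(T ^^ (m - i)) ((T ^^ i) ((S ^^ m) x)) = (T ^^ (m - i + i)) ((S ^^ m) x)"
      by (simp only: funpow_add o_apply)
    also have "\<dots> = x"
      using i funpow_left_inverse[OF SX TS x, of m] by simp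
    finally have "x \<in> (T ^^ (m - i)) ` ?E" using i(2) by (metis imageI)
    then show "x \<in> (\<Union>i\<in>{1..m}. (T ^^ i) ` ?E)"
      using i(1) by (intro UN_I[of "m - i"]) auto
  qed
  ultimately show ?thesis unfolding marker_def using EX \<open>m \<ge> 1\<close> by blast
qed

text \<open>The distance to the complement of \<open>F\<close> is positive exactly on
  \<open>F\<close>. Every backward orbit meets \<open>F\<close> within \<open>m\<close> steps, so
  compactness gives a uniform level that this distance reaches along each of them; \<open>w\<close>
  is the distance rescaled and capped at that level.\<close>

lemma marker_weight:
  assumes X: "compact X" and hom: "homeomorphism X X T S"
    and F: "openin (top_of_set X) F" "marker X T n F" and n: "n \<ge> 2"
  obtains w :: "'a::metric_space \<Rightarrow> real" and m where
    "continuous_on X w"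
    "\<And>x. x \<in> X \<Longrightarrow> w x \<noteq> 0 \<Longrightarrow> x \<in> F"
    "\<And>x. x \<in> X \<Longrightarrow> \<exists>i\<le>m. w ((S ^^ i) x) = 1"
proof (cases "X = {}")
  case True
  then show ?thesis using that[of "\<lambda>_. 0"] by auto
next
  case False
  have TX: "T ` X \<subseteq> X" and SX: "S ` X \<subseteq> X" and ST: "\<And>x. x \<in> X \<Longrightarrow> S (T x) = x"
    and cS: "continuous_on X S"
    using hom by (auto simp: homeomorphism_def)
  have FX: "F \<subseteq> X" using F(2) by (simp add: marker_def)
  obtain m where m: "m \<ge> 1" "X \<subseteq> (\<Union>i\<in>{1..m}. (T ^^ i) ` F)"
    using F(2) by (auto simp: marker_def)
  \<comment> \<open>\<open>infdist\<close> to the empty set is 0, so \<open>d\<close> would vanish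
    everywhere if \<open>F\<close> were all of \<open>X\<close>.\<close>
  have "F \<inter> T ` F = {}" using marker_disjoint[OF F(2), of 1] n by simp
  then have ne: "X - F \<noteq> {}"
    using False FX TX by blast
  define d where "d x = infdist x (X - F)" for x
  have d_pos: "d x > 0" if "x \<in> F" for x
  proof -
    have "closedin (top_of_set X) (X - F)" using F(1) by (simp add: openin_closedin_eq)
    then have "closed (X - F)"
      using X closedin_closed_trans compact_imp_closed by blast
    then show ?thesis
      unfolding d_def using infdist_pos_not_in_closed ne that by blast
  qed
  have cd: "continuous_on A d" for A
    unfolding d_def by (intro continuous_intros)
  define g where "g x = (\<Sum>i\<in>{1..m}. d ((S ^^ i) x))" for x
  have cg: "continuous_on X g"
    unfolding g_def
    by (intro continuous_on_sum continuous_on_compose2[OF cd] continuous_on_funpow cS SX) auto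
  have g_pos: "g x > 0" if x: "x \<in> X" for x
  proof -
    obtain i y where i: "i \<in> {1..m}" "y \<in> F" "x = (T ^^ i) y" using m(2) x by blast
    then have "(S ^^ i) x \<in> F" using funpow_left_inverse[OF TX ST] FX by auto
    then show ?thesis unfolding g_def
      by (intro sum_pos2[OF _ i(1)] d_pos) (auto simp: d_def infdist_nonneg)
  qed
  obtain z where z: "z \<in> X" "\<And>x. x \<in> X \<Longrightarrow> g z \<le> g x"
    using continuous_attains_inf[OF X False cg] by blast
  \<comment> \<open>If all \<open>m\<close> terms of \<open>g x\<close> were below \<open>c\<close>,
    then \<open>g x\<close> would be below the minimum \<open>g z\<close>.\<close>
  define c where "c = g z / real m"
  have c: "c > 0" using g_pos[OF z(1)] m(1) by (simp add: c_def)
  define w where "w x = min 1 (d x / c)" for x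
  show ?thesis
  proof
    show "continuous_on X w"
      unfolding w_def using c by (intro continuous_intros cd) auto
    show "x \<in> F" if "x \<in> X" "w x \<noteq> 0" for x
    proof (rule ccontr)
      assume "x \<notin> F"
      then have "d x = 0" using that(1) by (simp add: d_def)
      then show False using that(2) by (simp add: w_def)
    qed
    show "\<exists>i\<le>m. w ((S ^^ i) x) = 1" if x: "x \<in> X" for x
    proof (rule ccontr)
      assume *: "\<not> ?thesis"
      have "d ((S ^^ i) x) < c" if "i \<in> {1..m}" for i
      proof -
        have "w ((S ^^ i) x) \<noteq> 1" using * that by auto
        then show ?thesis using c by (auto simp: w_def min_def field_simps split: if_splits)
      qed
      then have "g x < (\<Sum>i\<in>{1..m}. c)"
        unfolding g_def using m(1) by (intro sum_strict_mono) auto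
      also have "\<dots> = g z" using m(1) by (simp add: c_def)
      finally show False using z(2)[OF x] by simp
    qed
  qed
qed

lemma Rokhlin_function:
  fixes w :: "'a::metric_space \<Rightarrow> real"
  assumes hom: "homeomorphism X X T S" and cw: "continuous_on X w"
    and stop: "\<And>x. x \<in> X \<Longrightarrow> \<exists>i\<le>m. w ((S ^^ i) x) = 1"
  obtains f :: "'a \<Rightarrow> real" where
    "continuous_on X f" "\<And>x. x \<in> exceptional_set X T f \<Longrightarrow> w (T x) \<noteq> 0"
proof -
  have SX: "S ` X \<subseteq> X" and ST: "\<And>x. x \<in> X \<Longrightarrow> S (T x) = x"
    and cS: "continuous_on X S"
    using hom by (auto simp: homeomorphism_def)
  \<comment> \<open>\<open>p k x\<close> is the probability that the backward walk from \<open>x\<close> makes more than \<open>k\<close> steps.\<close>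
  define p where "p k x = (\<Prod>j\<le>k. 1 - w ((S ^^ j) x))" for k x
  \<comment> \<open>The expectation is the sum of the tail probabilities. On \<open>X\<close> those
    beyond \<open>m\<close> vanish, since by \<open>stop\<close> they contain a factor 0.\<close>
  define f where "f x = (\<Sum>k\<le>m. p k x)" for x
  have "continuous_on X f"
    unfolding f_def p_def
    by (intro continuous_intros continuous_on_compose2[OF cw] continuous_on_funpow cS SX)
       (auto intro: funpow_mem[OF SX])
  moreover have "f (T x) = f x + 1" if x: "x \<in> X" and "w (T x) = 0" for x
  proof -
    have p0: "p 0 (T x) = 1" using that by (simp add: p_def)
    \<comment> \<open>The walk from \<open>T x\<close> passes its first point surely, as
      \<open>w (T x) = 0\<close>, and then continues as the walk from \<open>x\<close>.\<close>
    have pS: "p (Suc k) (T x) = p k x" for k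
      using that ST[OF x]
      by (simp add: p_def prod.atMost_Suc_shift funpow_Suc_right del: funpow.simps(2) prod.atMost_Suc)
    have pm: "p m x = 0" using stop[OF x] by (auto simp: p_def)
    \<comment> \<open>The added term equals \<open>p m x = 0\<close>; it makes the index shift
      exact.\<close>
    have "f (T x) + p (Suc m) (T x) = (\<Sum>k\<le>Suc m. p k (T x))" by (simp add: f_def)
    also have "\<dots> = 1 + f x"
      by (simp add: sum.atMost_Suc_shift p0 pS f_def del: sum.atMost_Suc)
    finally show ?thesis by (simp add: pS pm)
  qed
  ultimately show ?thesis using that by (fastforce simp: exceptional_set_def)
qed

text \<open>Visits to \<open>E\<close> at times \<open>i < j\<close> give visits to \<open>F\<close>
  at times \<open>i + 1\<close> and \<open>j + 1\<close>, so \<open>F\<close> would meet its image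
  under \<open>T ^^ (j - i)\<close>, where \<open>0 < j - i < n\<close>.\<close>

lemma disjoint_preimages_of_marker:
  assumes TX: "T ` X \<subseteq> X" and F: "marker X T n F"
    and E: "\<And>x. x \<in> E \<Longrightarrow> T x \<in> F"
  shows "disjoint_family_on (\<lambda>i. (T ^^ i) -` E \<inter> X) {0..<n}"
proof -
  have False if "i < j" "j < n" "(T ^^ i) x \<in> E" "(T ^^ j) x \<in> E" for i j x
  proof -
    have "(T ^^ Suc j) x = (T ^^ (j - i + Suc i)) x" using that(1) by simp
    also have "\<dots> = (T ^^ (j - i)) ((T ^^ Suc i) x)" by (simp only: funpow_add o_apply)
    finally have "(T ^^ Suc j) x \<in> (T ^^ (j - i)) ` F"
      using E[OF that(3)] by simp
    moreover have "(T ^^ Suc j) x \<in> F" using E[OF that(4)] by simp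
    moreover have "F \<inter> (T ^^ (j - i)) ` F = {}"
      using that(1,2) by (intro marker_disjoint[OF F]) auto
    ultimately show False by blast
  qed
  then show ?thesis
    unfolding disjoint_family_on_def by (auto, metis linorder_neqE_nat)
qed

theorem theorem5p7:
  fixes X :: "'a::metric_space set" and T :: "'a \<Rightarrow> 'a"
  assumes "topological_dynamical_system X T"
  shows "strong_topological_Rokhlin_property X T \<longleftrightarrow> marker_property X T"
proof -
  obtain S where X: "compact X" and hom: "homeomorphism X X T S"
    using assms by (auto simp: topological_dynamical_system_def)
  have TX: "T ` X \<subseteq> X" and cT: "continuous_on X T"
    using hom by (auto simp: homeomorphism_def)
  show ?thesis
  proof
    assume "strong_topological_Rokhlin_property X T"
    then show "marker_property X T"
      unfolding strong_topological_Rokhlin_property_def marker_property_def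
      using openin_exceptional_set[OF cT TX] marker_exceptional_set[OF X hom] by meson
  next
    assume M: "marker_property X T"
    show "strong_topological_Rokhlin_property X T"
      unfolding strong_topological_Rokhlin_property_def
    proof (intro allI impI)
      fix n :: nat assume n: "n \<ge> 1"
      \<comment> \<open>A \<open>1\<close>-marker may be all of \<open>X\<close>, leaving no complement to measure distances from.\<close>
      obtain F where F: "openin (top_of_set X) F" "marker X T (Suc n) F"
        using M unfolding marker_property_def by (auto dest: spec[of _ "Suc n"])
      obtain w :: "'a \<Rightarrow> real" and m where w: "continuous_on X w"
        "\<And>x. x \<in> X \<Longrightarrow> w x \<noteq> 0 \<Longrightarrow> x \<in> F"
        "\<And>x. x \<in> X \<Longrightarrow> \<exists>i\<le>m. w ((S ^^ i) x) = 1"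
        using marker_weight[OF X hom F] n by (metis Suc_le_mono numeral_2_eq_2 One_nat_def)
      obtain f where f: "continuous_on X f" "\<And>x. x \<in> exceptional_set X T f \<Longrightarrow> w (T x) \<noteq> 0"
        using Rokhlin_function[OF hom w(1,3)] by blast
      have "T x \<in> F" if "x \<in> exceptional_set X T f" for x
        using that f(2) w(2) TX by (auto simp: exceptional_set_def)
      then have "disjoint_family_on (\<lambda>i. (T ^^ i) -` exceptional_set X T f \<inter> X) {0..<Suc n}"
        by (rule disjoint_preimages_of_marker[OF TX F(2)])
      then show "\<exists>f. continuous_on X f \<and>
          disjoint_family_on (\<lambda>i. (T ^^ i) -` exceptional_set X T f \<inter> X) {0..<n}"
        using f(1) disjoint_family_on_mono[of "{0..<n}" "{0..<Suc n}"] by fastforce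
    qed
  qed
qed

end
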